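(* For every integer $n\ge 2$ and every odd integer $s\ge 1$, $\operatorname{Ssat}(u_s,n)\le \left(\frac{s+1}{2}\right)n+1$.
   Context: Sequences are finite words over an alphabet; a sequence on a given alphabet takes its letters from that alphabet (not every letter is required to appear). Two sequences are isomorphic if one is obtained from the other by a one-to-one renaming of letters. A copy of $u$ in a sequence is a (not necessarily contiguous) subsequence isomorphic to $u$. A sequence is $2$-sparse if no two adjacent letters are equal. For an integer $s\ge 0$, $u_s=xyxy\dots$ is the alternating sequence on two distinct letters $x,y$ of length $s+2$. A sequence on a given alphabet is $u_s$-semisaturated if it is $2$-sparse and inserting any letter of the alphabet at any position (including the beginning or the end) violates $2$-sparsity or creates a new copy of $u_s$, i.e. a copy that uses the inserted occurrence; the sequence itself need not avoid $u_s$. $\operatorname{Ssat}(u_s,n)$ is the minimum possible length of a $u_s$-semisaturated sequence on an alphabet of size $n$. *)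

theory Defs
  imports "HOL-Library.Extended_Nat"
begin

text \<open>
  Sequences are lists, and positions are counted from 0. 2-sparsity (no two adjacent letters
  are equal) is the library predicate \<^const>\<open>distinct_adj\<close>.
\<close>

definition seq_isomorphic :: "'b list \<Rightarrow> 'a list \<Rightarrow> bool" where
  "seq_isomorphic u v \<longleftrightarrow> (\<exists>f. inj_on f (set u) \<and> v = map f u)"

text \<open>
  A copy of \<open>u\<close> in \<open>w\<close> is identified with the set \<open>I\<close> of positions it occupies, so that one can
  say which occurrences of letters it uses.
\<close>

definition copy_at :: "'b list \<Rightarrow> 'a list \<Rightarrow> nat set \<Rightarrow> bool" where
  "copy_at u w I \<longleftrightarrow> I \<subseteq> {..<length w} \<and> seq_isomorphic u (nths w I)"

text \<open>The word $xyxy\ldots$ of length $s+2$, with $x = 0$ and $y = 1$.\<close>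

definition u_seq :: "nat \<Rightarrow> nat list" where
  "u_seq s = map (\<lambda>i. i mod 2) [0..<s + 2]"

text \<open>The inserted letter occupies position \<open>i\<close> of the result, for any \<open>i \<le> length w\<close>.\<close>

definition insert_letter :: "'a \<Rightarrow> nat \<Rightarrow> 'a list \<Rightarrow> 'a list" where
  "insert_letter a i w = take i w @ a # drop i w"

definition semisaturated :: "nat \<Rightarrow> 'a set \<Rightarrow> 'a list \<Rightarrow> bool" where
  "semisaturated s A w \<longleftrightarrow>
     set w \<subseteq> A \<and> distinct_adj w \<and>
     (\<forall>a\<in>A. \<forall>i\<le>length w.
        \<not> distinct_adj (insert_letter a i w) \<or>
        (\<exists>I. i \<in> I \<and> copy_at (u_seq s) (insert_letter a i w) I))"

text \<open>
  The alphabet of size \<open>n\<close> is \<open>{..<n}\<close>; renaming letters shows that the choice is immaterial.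
  The minimum is taken in \<^typ>\<open>enat\<close> so that it would be \<open>\<infinity>\<close> (rather than a default value) if
  there were no semisaturated sequence; a finite upper bound thus entails existence.
\<close>

definition Ssat :: "nat \<Rightarrow> nat \<Rightarrow> enat" where
  "Ssat s n = (INF w \<in> {w. semisaturated s {..<n} w}. enat (length w))"

end

theory Submission
  imports Defs "HOL-Library.Sublist"
begin

text \<open>
  Put \<open>k = (s + 1) div 2\<close>, so that \<open>u\<^sub>s\<close> is \<open>(xy)\<^sup>k x\<close>. The word
  \<open>W = (0 1 \<dots> n-1)\<^sup>k 0\<close> has length \<open>k n + 1\<close> and is semisaturated, although it is full of copies of
  \<open>u\<^sub>s\<close>: semisaturation only asks for a copy through the inserted occurrence, and the
  inserted letter can often take over the part of an old occurrence in a copy that is there already.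

  The \<open>k + 1\<close> zeros of \<open>W\<close> enclose \<open>k\<close> gaps, each containing every nonzero letter once.
  Consider an inserted letter \<open>a \<noteq> 0\<close>. In a gap, it replaces the \<open>a\<close> of that gap in the
  copy \<open>(0a)\<^sup>k 0\<close>. Before the first zero or after the last one, it extends \<open>(0a)\<^sup>k\<close> or
  \<open>(a0)\<^sup>k\<close> to the copy \<open>(a0)\<^sup>k a\<close>.

  An inserted zero that is not adjacent to another zero lies in a gap, somewhere after the letter
  \<open>1\<close> of that gap. It then replaces the zero that closes the gap in the copy
  \<open>(01)\<^sup>k 0\<close>: what follows in the copy lies behind that closing zero.
\<close>

section \<open>Copies through an inserted occurrence\<close>

abbreviation word_power :: "nat \<Rightarrow> 'a list \<Rightarrow> 'a list" where
  "word_power m w \<equiv> concat (replicate m w)"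

lemma word_power_split:
  assumes "q < k"
  shows "word_power k w = word_power q w @ w @ word_power (k - Suc q) w"
proof -
  have "replicate k w = replicate q w @ replicate (Suc (k - Suc q)) w"
    using assms by (simp flip: replicate_add replicate_Suc)
  then show ?thesis by simp
qed

lemma word_power_Suc_right: "word_power (Suc m) w = word_power m w @ w"
  by (induction m) auto

lemma alternation_shift: "word_power m [x, y] @ [x] = x # word_power m [y, x]"
  by (induction m) auto

lemma subseq_word_power:
  assumes "subseq v w"
  shows "subseq (word_power m v) (word_power m w)"
  by (induction m) (auto intro: list_emb_append_mono assms)

lemma u_seq_odd:
  assumes "s + 1 = 2 * k"
  shows "u_seq s = word_power k [0, 1] @ [0]"
proof -
  have "map (\<lambda>i. i mod 2) [0..<2 * k + 1] = word_power k [0, 1] @ [0 :: nat]"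
  proof (induction k)
    case (Suc k)
    have "word_power (Suc k) [0, 1] @ [0 :: nat] = (word_power k [0, 1] @ [0]) @ [1, 0]"
      by (simp only: word_power_Suc_right append_assoc append.simps)
    moreover have "[0..<2 * Suc k + 1] = [0..<2 * k + 1] @ [2 * k + 1, 2 * k + 2]"
      using upt_add_eq_append[of 0 "2 * k + 1" 2] by simp
    ultimately show ?case using Suc by simp
  qed simp
  moreover have "s + 2 = 2 * k + 1" using assms by simp
  ultimately show ?thesis unfolding u_seq_def by simp
qed

text \<open>
  Subsequences of the two sides of an occurrence can be chosen independently, which replaces
  the bookkeeping of position sets by the subsequence relation.
\<close>

lemma nths_through_occurrence:
  assumes "subseq p l" and "subseq q r"
  obtains I where "length l \<in> I" and "I \<subseteq> {..<length (l @ a # r)}"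
    and "nths (l @ a # r) I = p @ a # q"
proof -
  obtain M N where M: "p = nths l M" and N: "q = nths r N"
    using assms by (auto simp: subseq_conv_nths)
  define I where "I = (M \<inter> {..<length l}) \<union> {length l}
    \<union> ((\<lambda>j. j + Suc (length l)) ` (N \<inter> {..<length r}))"
  have "nths l I = nths l M"
    unfolding nths_def I_def
    by (intro arg_cong[where f = "map fst"] filter_cong) (auto simp: set_zip)
  moreover have "nths r {j. Suc j + length l \<in> I} = nths r N"
    unfolding nths_def I_def
    by (intro arg_cong[where f = "map fst"] filter_cong) (auto simp: set_zip)
  moreover have "length l \<in> I" by (simp add: I_def)
  ultimately have "nths (l @ a # r) I = p @ a # q"
    by (simp add: nths_append nths_Cons M N)
  moreover have "I \<subseteq> {..<length (l @ a # r)}" by (auto simp: I_def)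
  ultimately show ?thesis using that \<open>length l \<in> I\<close> by blast
qed

lemma copy_through_occurrence:
  assumes s: "s + 1 = 2 * k" and "x \<noteq> y"
    and pq: "p @ a # q = word_power k [x, y] @ [x]"
    and "subseq p l" and "subseq q r"
  shows "\<exists>I. length l \<in> I \<and> copy_at (u_seq s) (l @ a # r) I"
proof -
  obtain I where I: "length l \<in> I" "I \<subseteq> {..<length (l @ a # r)}"
    "nths (l @ a # r) I = p @ a # q"
    using nths_through_occurrence assms(4,5) by metis
  define f where "f j = (if j = 0 then x else y)" for j :: nat
  have "inj_on f (set (u_seq s))"
    using \<open>x \<noteq> y\<close> by (auto simp: inj_on_def f_def u_seq_def)
  moreover have "map f (u_seq s) = p @ a # q"
    by (simp add: u_seq_odd[OF s] pq map_concat f_def)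
  ultimately have "seq_isomorphic (u_seq s) (p @ a # q)"
    unfolding seq_isomorphic_def by metis
  then show ?thesis using I unfolding copy_at_def by auto
qed

section \<open>The periodic word\<close>

definition periodic_word :: "nat \<Rightarrow> nat \<Rightarrow> nat list" where
  "periodic_word n k = word_power k [0..<n] @ [0]"

lemma length_periodic_word: "length (periodic_word n k) = k * n + 1"
  by (simp add: periodic_word_def length_concat sum_list_replicate)

lemma set_periodic_word: "0 < n \<Longrightarrow> set (periodic_word n k) \<subseteq> {..<n}"
  by (auto simp: periodic_word_def)

lemma hd_periodic_word: "0 < n \<Longrightarrow> hd (periodic_word n k) = 0"
  by (cases k) (auto simp: periodic_word_def hd_append)

lemma distinct_adj_upt: "distinct_adj [m..<n]"
  by (simp add: distinct_adj_altdef remdups_adj_distinct)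

lemma distinct_adj_periodic_word:
  assumes "2 \<le> n"
  shows "distinct_adj (periodic_word n k)"
proof (induction k)
  case 0
  show ?case by (simp add: periodic_word_def)
next
  case (Suc k)
  have "periodic_word n (Suc k) = [0..<n] @ periodic_word n k"
    by (simp add: periodic_word_def)
  then show ?case
    using Suc assms hd_periodic_word[of n k]
    by (simp add: distinct_adj_append_iff distinct_adj_upt)
qed

lemma subseq_pair_upt:
  assumes "0 < a" and "a < n"
  shows "subseq [0, a] [0..<n]"
proof -
  have "[0..<n] = 0 # [1..<n]" using assms by (simp add: upt_conv_Cons)
  moreover have "subseq [a] [1..<n]" using assms by (simp add: subseq_singleton_left)
  ultimately show ?thesis by simp
qed

lemma subseq_alternation_periodic_word:
  assumes "0 < a" and "a < n"
  shows "subseq (word_power k [0, a] @ [0]) (periodic_word n k)"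
  unfolding periodic_word_def
  by (intro list_emb_append_mono subseq_word_power subseq_pair_upt assms) simp

text \<open>
  The remainder \<open>r\<close> runs from \<open>1\<close> to \<open>n\<close>, not from \<open>0\<close> to \<open>n - 1\<close>, so that the \<open>q\<close>-th gap between
  zeros, with both its ends, corresponds to a single quotient \<open>q\<close>.
\<close>

lemma split_periodic_word:
  assumes "0 < n" and "0 < i" and "i \<le> k * n"
  obtains q r where "q < k" and "0 < r" and "r \<le> n"
    and "take i (periodic_word n k) = word_power q [0..<n] @ [0..<r]"
    and "drop i (periodic_word n k) = [r..<n] @ periodic_word n (k - Suc q)"
proof -
  define q r where "q = (i - 1) div n" and "r = (i - 1) mod n + 1"
  have i: "i = q * n + r" using assms by (simp add: q_def r_def)
  have r: "0 < r" "r \<le> n" using assms by (auto simp: r_def Suc_leI)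
  have "i - 1 < k * n" using assms by simp
  then have q: "q < k" by (simp add: q_def less_mult_imp_div_less)
  have "periodic_word n k = word_power q [0..<n] @ [0..<n] @ periodic_word n (k - Suc q)"
    by (simp add: periodic_word_def word_power_split[OF q])
  moreover have "[0..<n] = [0..<r] @ [r..<n]"
    using r upt_add_eq_append[of 0 r "n - r"] by simp
  ultimately have "periodic_word n k
      = word_power q [0..<n] @ ([0..<r] @ [r..<n]) @ periodic_word n (k - Suc q)"
    by (simp only:)
  then have "periodic_word n k
      = (word_power q [0..<n] @ [0..<r]) @ [r..<n] @ periodic_word n (k - Suc q)"
    by (simp only: append_assoc)
  moreover have "length (word_power q [0..<n] @ [0..<r]) = i"
    by (simp add: i length_concat sum_list_replicate)
  ultimately show ?thesis using that[OF q r] by (metis append_eq_conv_conj)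
qed

section \<open>Insertions into the periodic word\<close>

lemma insert_nonzero_creates_copy:
  assumes s: "s + 1 = 2 * k" and a: "0 < a" "a < n" and i: "i \<le> k * n + 1"
  shows "\<exists>I. i \<in> I \<and> copy_at (u_seq s) (insert_letter a i (periodic_word n k)) I"
proof -
  let ?W = "periodic_word n k"
  have alt: "subseq (word_power m [0, a] @ [0]) (periodic_word n m)" for m
    by (rule subseq_alternation_periodic_word[OF a])
  consider "i = 0" | "i = k * n + 1" | "0 < i" "i \<le> k * n" using i by linarith
  then show ?thesis
  proof cases
    case 1
    have right: "subseq (word_power k [0, a]) ?W"
      using subseq_rev_drop_many[OF subseq_order.order_refl] alt[of k]
      by (rule subseq_order.order_trans)
    have eq: "[] @ a # word_power k [0, a] = word_power k [a, 0] @ [a]"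
      by (simp add: alternation_shift)
    from copy_through_occurrence[OF s _ eq list_emb_Nil[of _ "[]"] right] show ?thesis
      using a 1 by (simp add: insert_letter_def)
  next
    case 2
    have left: "subseq (word_power k [a, 0]) ?W"
      using alt[of k] by (metis alternation_shift subseq_Cons')
    from copy_through_occurrence[OF s _ refl left list_emb_Nil] show ?thesis
      using a 2 by (simp add: insert_letter_def length_periodic_word)
  next
    case 3
    then obtain q r where q: "q < k" and r: "0 < r" "r \<le> n"
      and l: "take i ?W = word_power q [0..<n] @ [0..<r]"
      and d: "drop i ?W = [r..<n] @ periodic_word n (k - Suc q)"
      using split_periodic_word[of n i k] a by auto
    have len: "length (take i ?W) = i" using i by (simp add: length_periodic_word)
    have "subseq [0] [0..<r]" using r by (simp add: subseq_singleton_left)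
    then have left: "subseq (word_power q [0, a] @ [0]) (take i ?W)"
      unfolding l by (intro list_emb_append_mono subseq_word_power subseq_pair_upt a)
    have right: "subseq (word_power (k - Suc q) [0, a] @ [0]) (drop i ?W)"
      unfolding d using alt by (simp add: list_emb_append2)
    \<comment> \<open>The inserted letter takes the place of the \<open>a\<close> of the gap that it falls into.\<close>
    have "(word_power q [0, a] @ [0]) @ a # word_power (k - Suc q) [0, a] @ [0]
        = word_power k [0, a] @ [0]"
      by (simp add: word_power_split[OF q])
    from copy_through_occurrence[OF s _ this left right, unfolded len] show ?thesis
      using a by (simp add: insert_letter_def)
  qed
qed

lemma insert_zero_creates_copy:
  assumes s: "s + 1 = 2 * k" and n: "2 \<le> n" and i: "i \<le> k * n + 1"
    and sparse: "distinct_adj (insert_letter 0 i (periodic_word n k))"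
  shows "\<exists>I. i \<in> I \<and> copy_at (u_seq s) (insert_letter 0 i (periodic_word n k)) I"
proof -
  let ?W = "periodic_word n k"
  have "i \<noteq> 0"
    using sparse n hd_periodic_word[of n k] length_periodic_word[of n k]
    by (cases i; cases "periodic_word n k") (auto simp: insert_letter_def)
  moreover have "i \<noteq> k * n + 1"
    using sparse length_periodic_word[of n k]
    by (auto simp: insert_letter_def distinct_adj_append_iff periodic_word_def)
  ultimately obtain q r where q: "q < k" and r: "0 < r" "r \<le> n"
    and l: "take i ?W = word_power q [0..<n] @ [0..<r]"
    and d: "drop i ?W = [r..<n] @ periodic_word n (k - Suc q)"
    using split_periodic_word[of n i k] i n by auto
  have len: "length (take i ?W) = i" using i by (simp add: length_periodic_word)
  have "r \<noteq> 1"
    using sparse by (auto simp: insert_letter_def l distinct_adj_append_iff)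
  then have "subseq [0, 1] [0..<r]" using r by (intro subseq_pair_upt) auto
  moreover have "subseq [0, 1] [0..<n]" using n by (intro subseq_pair_upt) auto
  ultimately have left: "subseq (word_power q [0, 1] @ [0, 1]) (take i ?W)"
    unfolding l by (intro list_emb_append_mono subseq_word_power)
  have "subseq (word_power (k - Suc q) [0, 1] @ [0]) (periodic_word n (k - Suc q))"
    using n by (intro subseq_alternation_periodic_word) auto
  \<comment> \<open>The leading zero, which closes the gap, gives way to the inserted one.\<close>
  then have "subseq (word_power (k - Suc q) [1, 0]) (periodic_word n (k - Suc q))"
    by (metis alternation_shift subseq_Cons')
  then have right: "subseq (word_power (k - Suc q) [1, 0]) (drop i ?W)"
    unfolding d by (simp add: list_emb_append2)
  have "(word_power q [0, 1] @ [0, 1]) @ 0 # word_power (k - Suc q) [1, 0]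
      = word_power k [0, 1] @ [0 :: nat]"
    by (simp add: word_power_split[OF q] alternation_shift)
  from copy_through_occurrence[OF s _ this left right, unfolded len] show ?thesis
    by (simp add: insert_letter_def)
qed

lemma semisaturated_periodic_word:
  assumes "s + 1 = 2 * k" and "2 \<le> n"
  shows "semisaturated s {..<n} (periodic_word n k)"
  unfolding semisaturated_def
proof (intro conjI ballI allI impI)
  show "set (periodic_word n k) \<subseteq> {..<n}" using assms by (intro set_periodic_word) auto
  show "distinct_adj (periodic_word n k)" using assms by (intro distinct_adj_periodic_word)
  fix a i
  assume "a \<in> {..<n}" and "i \<le> length (periodic_word n k)"
  then show "\<not> distinct_adj (insert_letter a i (periodic_word n k)) \<or>
      (\<exists>I. i \<in> I \<and> copy_at (u_seq s) (insert_letter a i (periodic_word n k)) I)"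
    using assms insert_zero_creates_copy[of s k n i] insert_nonzero_creates_copy[of s k a n i]
    by (cases "a = 0") (auto simp: length_periodic_word)
qed

theorem lemma4p7:
  fixes n s :: nat
  assumes "n \<ge> 2" and "odd s" and "s \<ge> 1"
  shows "Ssat s n \<le> enat (((s + 1) div 2) * n + 1)"
proof -
  have "s + 1 = 2 * ((s + 1) div 2)" using \<open>odd s\<close> by simp
  then have "semisaturated s {..<n} (periodic_word n ((s + 1) div 2))"
    using \<open>n \<ge> 2\<close> by (intro semisaturated_periodic_word)
  then show ?thesis
    unfolding Ssat_def by (intro INF_lower2) (auto simp: length_periodic_word)
qed

end
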